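(* Let $\mathcal{G}$ be the path graph with one branch on $n$ vertices, let $S\subseteq\{2,\ldots,n\}$ with $s:=|S|$, and let an admissible decomposition of $\mathcal{G}$ into three path graphs with segment lengths $d^i_j$ be given. Assume that $d^i_j$ is even for all $j\in\{2,\ldots,s_i\}$, $i\in\{1,2,3\}$, and that $d^1_{s_1+1}=d^2_1=d^3_1$. Then the compatibility constant is $$\kappa^2(S)=\frac{s+1}{n}\frac{1}{K^b},\qquad K^b=\sum_{i=1}^3\left(\frac{1}{d^i_1}+\sum_{j=2}^{s_i}\frac{4}{d^i_j}+\frac{1}{d^i_{s_i+1}}\right).$$
   Context: Branched path graph: $n=n_1+n_2$ vertices $1,\ldots,n$; edges $(i-1,i)$ for $2\le i\le n_1$ (main branch), $(b,n_1+1)$ with $1\le b<n_1$, and $(i-1,i)$ for $n_1+2\le i\le n$ (side branch). It is rooted at vertex $1$, each vertex $i\ge2$ has a parent (its neighbour towards the root), and the edge from the parent to $i$ is indexed by $i$; thus $S\subseteq\{2,\ldots,n\}$ is a set of edges. Path matrix: $X\in\mathbb{R}^{n\times n}$, $X_{ij}=1$ if $j$ lies on the path from $1$ to $i$ (endpoints included), $0$ otherwise. Compatibility constant: with $\|v\|_n^2=\frac1n\sum_iv_i^2$, $$\kappa^2(S):=\min\{(s+1)\|X\beta\|_n^2:\ \beta\in\mathbb{R}^n,\ \|\beta_S\|_1-\|\beta_{-(\{1\}\cup S)}\|_1=1\},$$ where $-(\{1\}\cup S)$ denotes the complement in $\{1,\ldots,n\}$. Admissible decomposition: $S$ is partitioned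 as $S_1=S\cap\{2,\ldots,b\}$, $S_2=S\cap\{b+1,\ldots,n_1\}$, $S_3=S\cap\{n_1+1,\ldots,n\}$, with $s_i=|S_i|\ge1$. By removing two edges not in $S$, the graph is decomposed into three vertex-disjoint path graphs $P^1,P^2,P^3$ covering all vertices, such that $P^i$ contains exactly the edges of $S$ lying in $S_i$; $P^1$ starts at vertex $1$, $P^2$ ends at vertex $n_1$, $P^3$ ends at vertex $n$. (The end of $P^1$ need not be $b$, and the starting points of $P^2,P^3$ need not be $b+1,n_1+1$.) Traversing $P^i$ in this direction, removal of the edges in $S_i$ cuts $P^i$ into $s_i+1$ consecutive segments with $d^i_1,\ldots,d^i_{s_i+1}$ vertices (so $\sum_i\sum_jd^i_j=n$). It is required that $d^i_1\ge2$, $d^i_{s_i+1}\ge2$ and $d^i_j\ge4$ for $2\le j\le s_i$, for every $i$. *)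

theory Defs
  imports Complex_Main
begin

text \<open>
  The branched path graph has vertices \<open>1, \<dots>, n1 + n2\<close>. Vectors in \<open>\<real>\<^sup>n\<close> and matrices in
  \<open>\<real>\<^bsup>n \<times> n\<^esup>\<close> are represented by functions on \<^typ>\<open>nat\<close> of which only the arguments
  in \<open>{1..n}\<close> are used.
\<close>

definition bp_vertices :: "nat \<Rightarrow> nat \<Rightarrow> nat set" where
  "bp_vertices n1 n2 = {1..n1 + n2}"

definition bp_parent :: "nat \<Rightarrow> nat \<Rightarrow> nat \<Rightarrow> nat" where
  "bp_parent n1 b i = (if i = n1 + 1 then b else i - 1)"

definition bp_edge :: "nat \<Rightarrow> nat \<Rightarrow> nat \<Rightarrow> nat set" where
  "bp_edge n1 b i = {bp_parent n1 b i, i}"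

definition bp_edges :: "nat \<Rightarrow> nat \<Rightarrow> nat \<Rightarrow> nat set set" where
  "bp_edges n1 n2 b = bp_edge n1 b ` {2..n1 + n2}"

text \<open>Paths are lists of vertices; the list order is the direction of traversal.\<close>

definition path_edges :: "nat list \<Rightarrow> nat set set" where
  "path_edges p = {{p ! k, p ! Suc k} | k. Suc k < length p}"

definition is_path :: "nat set \<Rightarrow> nat set set \<Rightarrow> nat list \<Rightarrow> bool" where
  "is_path V E p \<longleftrightarrow> p \<noteq> [] \<and> distinct p \<and> set p \<subseteq> V \<and> path_edges p \<subseteq> E"

definition path_matrix :: "nat \<Rightarrow> nat \<Rightarrow> nat \<Rightarrow> nat \<Rightarrow> nat \<Rightarrow> real" where
  "path_matrix n1 n2 b i j =
     (if \<exists>p. is_path (bp_vertices n1 n2) (bp_edges n1 n2 b) p \<and>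
             hd p = 1 \<and> last p = i \<and> j \<in> set p
      then 1 else 0)"

definition mat_vec :: "nat \<Rightarrow> (nat \<Rightarrow> nat \<Rightarrow> real) \<Rightarrow> (nat \<Rightarrow> real) \<Rightarrow> nat \<Rightarrow> real" where
  "mat_vec n A v i = (\<Sum>j=1..n. A i j * v j)"

definition emp_norm_sq :: "nat \<Rightarrow> (nat \<Rightarrow> real) \<Rightarrow> real" where
  "emp_norm_sq n v = 1 / real n * (\<Sum>i=1..n. (v i)\<^sup>2)"

definition l1_on :: "nat set \<Rightarrow> (nat \<Rightarrow> real) \<Rightarrow> real" where
  "l1_on A v = (\<Sum>i\<in>A. \<bar>v i\<bar>)"

definition compat_values :: "nat \<Rightarrow> nat \<Rightarrow> nat \<Rightarrow> nat set \<Rightarrow> real set" where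
  "compat_values n1 n2 b S =
     {(real (card S) + 1) * emp_norm_sq (n1 + n2) (mat_vec (n1 + n2) (path_matrix n1 n2 b) \<beta>) | \<beta>.
        l1_on S \<beta> - l1_on ({1..n1 + n2} - ({1} \<union> S)) \<beta> = 1}"

text \<open>
  The compatibility constant is a minimum. The infimum below is the minimum precisely when it
  belongs to \<^const>\<open>compat_values\<close>, which has to be asserted separately.
\<close>

definition kappa_sq :: "nat \<Rightarrow> nat \<Rightarrow> nat \<Rightarrow> nat set \<Rightarrow> real" where
  "kappa_sq n1 n2 b S = Inf (compat_values n1 n2 b S)"

definition S_part :: "nat \<Rightarrow> nat \<Rightarrow> nat \<Rightarrow> nat set \<Rightarrow> nat \<Rightarrow> nat set" where
  "S_part n1 n2 b S i =
     (if i = 1 then S \<inter> {2..b}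
      else if i = 2 then S \<inter> {b + 1..n1}
      else S \<inter> {n1 + 1..n1 + n2})"

text \<open>
  Removing the edges \<open>C\<close> from the path \<open>p\<close> leaves the consecutive segments \<open>qs\<close>: they
  concatenate to \<open>p\<close>, and the edges inside segments are exactly the edges of \<open>p\<close> not in \<open>C\<close>
  (so the edges joining consecutive segments are exactly those in \<open>C\<close>).
\<close>

definition cuts_into :: "nat set set \<Rightarrow> nat list \<Rightarrow> nat list list \<Rightarrow> bool" where
  "cuts_into C p qs \<longleftrightarrow>
     concat qs = p \<and> [] \<notin> set qs \<and> (\<Union>q\<in>set qs. path_edges q) = path_edges p - C"

text \<open>
  \<open>P i\<close> is the vertex list of the \<open>i\<close>-th path (\<open>i \<in> {1, 2, 3}\<close>) in its direction of traversal
  and \<open>d i j\<close> the number of vertices of its \<open>j\<close>-th segment. The clause on the edge sets says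
  that deleting the edges \<open>e\<close> and \<open>e'\<close> leaves the disjoint union of the three path graphs.
\<close>

definition admissible_decomposition ::
  "nat \<Rightarrow> nat \<Rightarrow> nat \<Rightarrow> nat set \<Rightarrow> (nat \<Rightarrow> nat list) \<Rightarrow> (nat \<Rightarrow> nat \<Rightarrow> nat) \<Rightarrow> bool" where
  "admissible_decomposition n1 n2 b S P d \<longleftrightarrow>
     (\<exists>e e'. e \<in> {2..n1 + n2} - S \<and> e' \<in> {2..n1 + n2} - S \<and> e \<noteq> e' \<and>
        bp_edges n1 n2 b - {bp_edge n1 b e, bp_edge n1 b e'} = (\<Union>i\<in>{1,2,3}. path_edges (P i))) \<and>
     (\<forall>i\<in>{1,2,3}. is_path (bp_vertices n1 n2) (bp_edges n1 n2 b) (P i)) \<and>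
     (\<Union>i\<in>{1,2,3}. set (P i)) = bp_vertices n1 n2 \<and>
     (\<forall>i\<in>{1,2,3}. \<forall>i'\<in>{1,2,3}. i \<noteq> i' \<longrightarrow> set (P i) \<inter> set (P i') = {}) \<and>
     hd (P 1) = 1 \<and> last (P 2) = n1 \<and> last (P 3) = n1 + n2 \<and>
     (\<forall>i\<in>{1,2,3}.
        let s = card (S_part n1 n2 b S i) in
          s \<ge> 1 \<and>
          {k \<in> S. bp_edge n1 b k \<in> path_edges (P i)} = S_part n1 n2 b S i \<and>
          (\<exists>qs. cuts_into (bp_edge n1 b ` S_part n1 n2 b S i) (P i) qs \<and>
                length qs = s + 1 \<and> (\<forall>j\<in>{1..s + 1}. d i j = length (qs ! (j - 1)))) \<and>
          d i 1 \<ge> 2 \<and> d i (s + 1) \<ge> 2 \<and> (\<forall>j\<in>{2..s}. d i j \<ge> 4))"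

text \<open>\<open>s i\<close> is the number of cut edges in the \<open>i\<close>-th path.\<close>

definition K_branch :: "(nat \<Rightarrow> nat) \<Rightarrow> (nat \<Rightarrow> nat \<Rightarrow> nat) \<Rightarrow> real" where
  "K_branch s d =
     (\<Sum>i=1..3. 1 / real (d i 1) + (\<Sum>j=2..s i. 4 / real (d i j)) + 1 / real (d i (s i + 1)))"

end

theory Submission
  imports Defs
begin

text \<open>
  With \<open>f = X \<beta>\<close>, the coordinate \<open>\<beta> i\<close> is the increment \<open>f i - f (par i)\<close> of \<open>f\<close> along the edge
  \<open>i\<close>. The problem is therefore to minimise the squared norm of a signal \<open>f\<close> on the tree under the
  constraint that its \<^emph>\<open>excess\<close>, the total jump over the edges in \<open>S\<close> minus the total jump over
  the other edges below the root, equals \<open>1\<close>.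

  \<^bold>\<open>Lower bound.\<close> Give every vertex of a segment of length \<open>d\<close> the weight \<open>w = 1 / d\<close> if the
  segment is the first or last one of its path, and \<open>w = 2 / d\<close> otherwise. The jump over an edge of
  \<open>S\<close> is at most the sum of the absolute values at its two endpoints. The absolute value at an
  endpoint of a segment, reduced by the variation of \<open>f\<close> inside the segment, is at most the average
  of \<open>\<bar>f\<bar>\<close> over the segment; if both endpoints carry an edge of \<open>S\<close>, each of them uses its own half
  of the segment, and this is where the even lengths enter. Hence on each path the excess
  is at most the weighted sum of \<open>\<bar>f\<bar>\<close> (\<open>cut_path_bound\<close>). Deleting the two edges that join the
  paths only increases the excess, so the bound adds up over the three paths (\<open>excess_le\<close>). The sum
  of the squares of all weights is \<open>K\<close>, so an excess of \<open>1\<close> forces the squared norm to be at least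
  \<open>1 / K\<close> (\<open>norm_bound\<close>).

  \<^bold>\<open>Attainment.\<close> Equality holds for the signal whose absolute values are the weights and whose
  sign flips across exactly the edges in \<open>S\<close>, provided that it does not jump across the two deleted
  edges. The equality of the lengths of the last segment of \<open>P 1\<close> and the first segments of \<open>P 2\<close>
  and \<open>P 3\<close> makes the weights agree on these three segments, but it has to be known that the deleted
  edges have both ends in these segments. To see this without following the paths through the tree, count
  for each vertex and each \<open>j\<close> the edges of \<open>S\<^sub>j\<close> on the way down from the root (\<open>level\<close>). An edge
  outside \<open>S\<close> preserves all three levels, and the levels determine the segment of a vertex up to the
  identification of the three segments in question (\<open>levels\<close>): consecutive segments of \<open>P i\<close> differ
  by at most one in the level belonging to \<open>S\<^sub>i\<close>, and the \<open>s i\<close> available steps are just enough to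
  climb from level \<open>0\<close> to level \<open>s i\<close>, so the \<open>k\<close>-th segment, counted from \<open>0\<close>, has level \<open>k\<close>
  (\<open>segment_levels\<close>). The extremal signal is thus a function of the levels alone, and it is constant
  across edges outside \<open>S\<close>.
\<close>

section \<open>Paths as vertex lists\<close>

lemma path_edges_Nil [simp]: "path_edges [] = {}"
  by (simp add: path_edges_def)

lemma path_edges_single [simp]: "path_edges [x] = {}"
  by (simp add: path_edges_def)

lemma path_edges_Cons_Cons [simp]:
  "path_edges (x # y # p) = insert {x, y} (path_edges (y # p))"
proof -
  have "e \<in> path_edges (x # y # p) \<longleftrightarrow> e \<in> insert {x, y} (path_edges (y # p))" for e
  proof -
    have "e \<in> path_edges (x # y # p) \<longleftrightarrow>
        (\<exists>k. e = {(x # y # p) ! k, (x # y # p) ! Suc k} \<and> Suc k < length (x # y # p))"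
      by (auto simp: path_edges_def)
    also have "\<dots> \<longleftrightarrow> e = {x, y} \<or>
        (\<exists>k. e = {(y # p) ! k, (y # p) ! Suc k} \<and> Suc k < length (y # p))"
      (is "(\<exists>k. ?A k) \<longleftrightarrow> _ \<or> (\<exists>k. ?B k)")
    proof
      assume "\<exists>k. ?A k"
      then obtain k where "?A k" by blast
      then show "e = {x, y} \<or> (\<exists>k. ?B k)" by (cases k) auto
    next
      assume "e = {x, y} \<or> (\<exists>k. ?B k)"
      then show "\<exists>k. ?A k"
      proof
        assume "e = {x, y}"
        then have "?A 0" by simp
        then show ?thesis by blast
      next
        assume "\<exists>k. ?B k"
        then obtain k where "?B k" by blast
        then have "?A (Suc k)" by simp
        then show ?thesis by blast
      qed
    qed
    finally show ?thesis by (auto simp: path_edges_def)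
  qed
  then show ?thesis by blast
qed

lemma path_edges_append:
  "p \<noteq> [] \<Longrightarrow> q \<noteq> [] \<Longrightarrow>
   path_edges (p @ q) = insert {last p, hd q} (path_edges p \<union> path_edges q)"
proof (induction p rule: induct_list012)
  case (2 x)
  then show ?case by (cases q) auto
qed auto

lemma path_edges_subset: "e \<in> path_edges p \<Longrightarrow> e \<subseteq> set p"
  by (induction p rule: induct_list012) auto

lemma path_edges_nonempty: "e \<in> path_edges p \<Longrightarrow> e \<noteq> {}"
  by (induction p rule: induct_list012) auto

lemma finite_path_edges [simp]: "finite (path_edges p)"
  by (induction p rule: induct_list012) auto

lemma path_edges_disjoint:
  assumes "set p \<inter> set q = {}"
  shows "path_edges p \<inter> path_edges q = {}"
proof -
  have "e = {}" if "e \<in> path_edges p" "e \<in> path_edges q" for e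
    using path_edges_subset[OF that(1)] path_edges_subset[OF that(2)] assms by blast
  then show ?thesis using path_edges_nonempty by blast
qed

lemma constant_on_path:
  assumes "\<And>x y. {x, y} \<in> path_edges p \<Longrightarrow> c x = c y"
    and "u \<in> set p" and "v \<in> set p"
  shows "c u = c v"
proof -
  have "\<exists>l. \<forall>v\<in>set p. c v = l"
    using assms(1)
  proof (induction p rule: induct_list012)
    case (3 x y p)
    have "c x = c y" by (rule 3(3)) simp
    moreover have "\<exists>l. \<forall>v\<in>set (y # p). c v = l"
      by (rule 3(2), rule 3(3)) simp
    ultimately show ?case by auto
  qed auto
  then show ?thesis using assms(2,3) by auto
qed

lemma sum_segments:
  fixes h :: "'a \<Rightarrow> real"
  shows "distinct (concat qs) \<Longrightarrow>
    (\<Sum>v\<in>set (concat qs). h v) = (\<Sum>k<length qs. \<Sum>v\<in>set (qs ! k). h v)"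
proof (induction qs)
  case (Cons q qs)
  then show ?case
    by (simp add: sum.union_disjoint sum.lessThan_Suc_shift del: sum.lessThan_Suc)
qed simp

lemma junction_in_path_edges:
  "[] \<notin> set qs \<Longrightarrow> Suc k < length qs \<Longrightarrow>
   {last (qs ! k), hd (qs ! Suc k)} \<in> path_edges (concat qs)"
proof (induction qs arbitrary: k)
  case (Cons q qs)
  then obtain r rs where qs: "qs = r # rs" by (cases qs) auto
  have "q \<noteq> []" "r \<noteq> []" using Cons.prems(1) qs by auto
  then have pe: "path_edges (concat (q # qs)) =
      insert {last q, hd r} (path_edges q \<union> path_edges (concat qs))"
    using path_edges_append[of q "concat qs"] qs by simp
  show ?case
  proof (cases k)
    case 0
    then show ?thesis using pe qs by simp
  next
    case (Suc l)
    then show ?thesis using Cons.IH[of l] Cons.prems pe by simp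
  qed
qed simp

section \<open>Total variation along a path\<close>

fun variation :: "('a \<Rightarrow> real) \<Rightarrow> 'a list \<Rightarrow> real" where
  "variation f (x # y # p) = \<bar>f x - f y\<bar> + variation f (y # p)"
| "variation f _ = 0"

text \<open>
  An edge is an unordered pair; \<open>Max\<close> and \<open>Min\<close> pick its two ends, so that jumps can be summed over
  sets of edges.
\<close>

definition edge_jump :: "(nat \<Rightarrow> real) \<Rightarrow> nat set \<Rightarrow> real" where
  "edge_jump f e = \<bar>f (Max e) - f (Min e)\<bar>"

lemma edge_jump_pair [simp]: "edge_jump f {x, y} = \<bar>f x - f y\<bar>"
  by (cases "x \<le> y") (auto simp: edge_jump_def max_def min_def)

lemma edge_jump_nonneg [simp]: "0 \<le> edge_jump f e"
  by (simp add: edge_jump_def)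

lemma variation_nonneg [simp]: "0 \<le> variation f p"
  by (induction p rule: induct_list012) auto

lemma variation_append:
  "p \<noteq> [] \<Longrightarrow> q \<noteq> [] \<Longrightarrow>
   variation f (p @ q) = variation f p + \<bar>f (last p) - f (hd q)\<bar> + variation f q"
proof (induction p rule: induct_list012)
  case (2 x)
  then show ?case by (cases q) auto
qed auto

lemma variation_concat:
  assumes "[] \<notin> set qs" and "length qs = Suc s"
  shows "variation f (concat qs) =
    (\<Sum>k<s. \<bar>f (last (qs ! k)) - f (hd (qs ! Suc k))\<bar>) + (\<Sum>k<Suc s. variation f (qs ! k))"
  using assms
proof (induction s arbitrary: qs)
  case 0
  then obtain q where "qs = [q]" by (auto simp: length_Suc_conv)
  then show ?case by simp
next
  case (Suc s)
  then obtain q r rs where qs: "qs = q # r # rs" by (auto simp: length_Suc_conv)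
  have "variation f (concat qs) =
      variation f q + \<bar>f (last q) - f (hd r)\<bar> + variation f (concat (r # rs))"
    using Suc.prems variation_append[of q "concat (r # rs)" f] by (auto simp: qs)
  also have "variation f (concat (r # rs)) =
      (\<Sum>k<s. \<bar>f (last ((r # rs) ! k)) - f (hd ((r # rs) ! Suc k))\<bar>)
        + (\<Sum>k<Suc s. variation f ((r # rs) ! k))"
    using Suc.prems by (intro Suc.IH) (auto simp: qs)
  finally show ?case
    by (simp add: qs sum.lessThan_Suc_shift del: sum.lessThan_Suc)
qed

lemma sum_edge_jump_path:
  "distinct p \<Longrightarrow> (\<Sum>e\<in>path_edges p. edge_jump f e) = variation f p"
proof (induction p rule: induct_list012)
  case (3 x y p)
  have "{x, y} \<notin> path_edges (y # p)"
    using path_edges_subset[of "{x, y}" "y # p"] 3(3) by auto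
  then show ?case using 3 by simp
qed auto

lemma sum_edge_jump_segments:
  "distinct (concat qs) \<Longrightarrow>
   (\<Sum>e\<in>(\<Union>q\<in>set qs. path_edges q). edge_jump f e) = (\<Sum>k<length qs. variation f (qs ! k))"
proof (induction qs)
  case (Cons q qs)
  have "path_edges q \<inter> path_edges r = {}" if "r \<in> set qs" for r
    using Cons.prems that by (intro path_edges_disjoint) auto
  then have "path_edges q \<inter> (\<Union>r\<in>set qs. path_edges r) = {}" by blast
  then show ?case using Cons
    by (simp add: sum.union_disjoint sum_edge_jump_path sum.lessThan_Suc_shift
        del: sum.lessThan_Suc)
qed auto

text \<open>
  The variation inside the segments is what remains of the variation of the whole path once the
  cut edges are taken out, so the cut edges carry exactly the jumps between consecutive segments.
\<close>

lemma sum_edge_jump_cut: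
  assumes "cuts_into C p qs" and "distinct p" and "C \<subseteq> path_edges p" and "length qs = Suc s"
  shows "(\<Sum>e\<in>C. edge_jump f e) = (\<Sum>k<s. \<bar>f (last (qs ! k)) - f (hd (qs ! Suc k))\<bar>)"
    and "(\<Sum>e\<in>path_edges p - C. edge_jump f e) = (\<Sum>k<Suc s. variation f (qs ! k))"
proof -
  have c: "concat qs = p" "[] \<notin> set qs" "path_edges p - C = (\<Union>q\<in>set qs. path_edges q)"
    using assms(1) by (auto simp: cuts_into_def)
  show inner: "(\<Sum>e\<in>path_edges p - C. edge_jump f e) = (\<Sum>k<Suc s. variation f (qs ! k))"
    using sum_edge_jump_segments[of qs f] c assms(2,4) by simp
  have "(\<Sum>e\<in>path_edges p - C. edge_jump f e) + (\<Sum>e\<in>C. edge_jump f e) = variation f p"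
    using sum.subset_diff[OF assms(3) finite_path_edges, of "edge_jump f"]
      sum_edge_jump_path[OF assms(2), of f] by simp
  then show "(\<Sum>e\<in>C. edge_jump f e) = (\<Sum>k<s. \<bar>f (last (qs ! k)) - f (hd (qs ! Suc k))\<bar>)"
    using inner variation_concat[OF c(2) assms(4), of f] c(1) by simp
qed

section \<open>The inequality on a single cut path\<close>

lemma abs_diff_le_variation:
  "u \<in> set p \<Longrightarrow> v \<in> set p \<Longrightarrow> \<bar>f u - f v\<bar> \<le> variation f p"
proof (induction p arbitrary: u v rule: induct_list012)
  case (3 x y p)
  have y: "\<bar>f w - f y\<bar> \<le> variation f (y # p)" if "w \<in> set (y # p)" for w
    using 3(2)[of w y] that by simp
  have "\<bar>f w - f x\<bar> \<le> variation f (x # y # p)" if "w \<in> set (y # p)" for w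
    using y[OF that] by simp
  moreover have "\<bar>f u - f v\<bar> \<le> variation f (x # y # p)"
    if "u \<in> set (y # p)" "v \<in> set (y # p)"
    using 3(2)[OF that] by simp
  moreover have "u = x \<or> u \<in> set (y # p)" "v = x \<or> v \<in> set (y # p)"
    using 3(3,4) by auto
  ultimately show ?case by (metis abs_minus_commute diff_self abs_zero variation_nonneg)
qed auto

text \<open>
  From \<open>v\<close> no vertex \<open>u\<close> of the segment can be reached without paying \<open>\<bar>f u - f v\<bar>\<close> of variation, so
  the left-hand side is below \<open>\<bar>f u\<bar>\<close> for every \<open>u\<close>, hence below the average.
\<close>

lemma end_bound:
  assumes "distinct q" and "v \<in> set q"
  shows "\<bar>f v\<bar> - variation f q \<le> 1 / real (length q) * (\<Sum>u\<in>set q. \<bar>f u\<bar>)"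
proof -
  have "\<bar>f v\<bar> - variation f q \<le> \<bar>f u\<bar>" if "u \<in> set q" for u
    using abs_diff_le_variation[OF assms(2) that, of f] by linarith
  then have "real (card (set q)) * (\<bar>f v\<bar> - variation f q) \<le> (\<Sum>u\<in>set q. \<bar>f u\<bar>)"
    by (rule sum_bounded_below)
  moreover have "card (set q) = length q" "length q > 0"
    using assms by (auto simp: distinct_card)
  ultimately show ?thesis by (simp add: field_simps)
qed

text \<open>
  The two halves of the segment have disjoint edges, so each endpoint can be compared with the
  average over its own half.
\<close>

lemma middle_bound:
  assumes "distinct q" and "q \<noteq> []" and "even (length q)"
  shows "\<bar>f (hd q)\<bar> + \<bar>f (last q)\<bar> - variation f q
    \<le> 2 / real (length q) * (\<Sum>u\<in>set q. \<bar>f u\<bar>)"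
proof -
  obtain m where m: "length q = 2 * m" using assms(3) by (elim evenE)
  define x where "x = take m q"
  define y where "y = drop m q"
  have q: "q = x @ y" and len: "length x = m" "length y = m"
    using m by (auto simp: x_def y_def)
  have "m > 0" using m assms(2) by (cases m) auto
  then have ne: "x \<noteq> []" "y \<noteq> []" using len by auto
  have xy: "distinct x" "distinct y" "set x \<inter> set y = {}" using assms(1) q by auto
  have "\<bar>f (hd x)\<bar> - variation f x \<le> 1 / m * (\<Sum>u\<in>set x. \<bar>f u\<bar>)"
    using end_bound[OF xy(1), of "hd x" f] ne len by simp
  moreover have "\<bar>f (last y)\<bar> - variation f y \<le> 1 / m * (\<Sum>u\<in>set y. \<bar>f u\<bar>)"
    using end_bound[OF xy(2), of "last y" f] ne len by simp
  moreover have "variation f x + variation f y \<le> variation f q"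
    using variation_append[OF ne, of f] by (simp add: q)
  moreover have "(\<Sum>u\<in>set q. \<bar>f u\<bar>) = (\<Sum>u\<in>set x. \<bar>f u\<bar>) + (\<Sum>u\<in>set y. \<bar>f u\<bar>)"
    using xy(3) by (simp add: q sum.union_disjoint)
  moreover have "2 / real (length q) = 1 / m" using \<open>m > 0\<close> by (simp add: m)
  ultimately show ?thesis using ne q by (simp add: algebra_simps)
qed

text \<open>
  The absolute value of the extremal signal, before normalisation, on the \<open>k\<close>-th segment. The sum of
  the squares of these values over the vertices of the path is its contribution to \<open>K\<close>.
\<close>

definition seg_weight :: "'a list list \<Rightarrow> nat \<Rightarrow> real" where
  "seg_weight qs k = (if k = 0 \<or> Suc k = length qs then 1 else 2) / real (length (qs ! k))"

definition cut_energy :: "'a list list \<Rightarrow> real" where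
  "cut_energy qs = (\<Sum>k<length qs. real (length (qs ! k)) * (seg_weight qs k)\<^sup>2)"

text \<open>
  Regroups a sum over cut edges into a sum over segments: every segment but the last has a cut edge
  at its end, and every segment but the first has one at its start.
\<close>

lemma sum_consecutive:
  fixes x y :: "nat \<Rightarrow> real"
  shows "(\<Sum>k<s. y k + x (Suc k)) =
    (\<Sum>k<Suc s. (if k < s then y k else 0) + (if 0 < k then x k else 0))"
proof -
  have "(\<Sum>k<Suc s. if k < s then y k else 0) = (\<Sum>k<s. y k)" by simp
  moreover have "(\<Sum>k<Suc s. if 0 < k then x k else 0) = (\<Sum>k<s. x (Suc k))"
    by (simp add: sum.lessThan_Suc_shift del: sum.lessThan_Suc)
  ultimately show ?thesis by (simp only: sum.distrib)
qed

lemma cut_path_bound: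
  assumes "distinct (concat qs)" and "[] \<notin> set qs" and "length qs = Suc s" and "s \<ge> 1"
    and even: "\<And>k. 0 < k \<Longrightarrow> k < s \<Longrightarrow> even (length (qs ! k))"
  shows "(\<Sum>k<s. \<bar>f (last (qs ! k)) - f (hd (qs ! Suc k))\<bar>) - (\<Sum>k<Suc s. variation f (qs ! k))
    \<le> (\<Sum>k<Suc s. seg_weight qs k * (\<Sum>u\<in>set (qs ! k). \<bar>f u\<bar>))"
proof -
  let ?x = "\<lambda>k. \<bar>f (hd (qs ! k))\<bar>" and ?y = "\<lambda>k. \<bar>f (last (qs ! k))\<bar>"
  have "(\<Sum>k<s. \<bar>f (last (qs ! k)) - f (hd (qs ! Suc k))\<bar>) \<le> (\<Sum>k<s. ?y k + ?x (Suc k))"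
    by (intro sum_mono) linarith
  also have "\<dots> = (\<Sum>k<Suc s. (if k < s then ?y k else 0) + (if 0 < k then ?x k else 0))"
    by (rule sum_consecutive)
  finally have "(\<Sum>k<s. \<bar>f (last (qs ! k)) - f (hd (qs ! Suc k))\<bar>)
        - (\<Sum>k<Suc s. variation f (qs ! k))
      \<le> (\<Sum>k<Suc s. (if k < s then ?y k else 0) + (if 0 < k then ?x k else 0)
            - variation f (qs ! k))"
    unfolding sum_subtractf by linarith
  also have "\<dots> \<le> (\<Sum>k<Suc s. seg_weight qs k * (\<Sum>u\<in>set (qs ! k). \<bar>f u\<bar>))"
  proof (rule sum_mono)
    fix k assume "k \<in> {..<Suc s}"
    then have k: "k < length qs" "k \<le> s" using assms(3) by auto
    then have mem: "qs ! k \<in> set qs" by simp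
    have ne: "qs ! k \<noteq> []" using assms(2) mem by metis
    have dist: "distinct (qs ! k)" using assms(1) mem by (simp add: distinct_concat_iff)
    consider "k = 0" | "k = s" "k > 0" | "0 < k" "k < s" using k(2) by linarith
    then show "(if k < s then ?y k else 0) + (if 0 < k then ?x k else 0) - variation f (qs ! k)
        \<le> seg_weight qs k * (\<Sum>u\<in>set (qs ! k). \<bar>f u\<bar>)"
    proof cases
      case 1
      then show ?thesis
        using end_bound[OF dist, of "last (qs ! k)" f] ne assms(4) by (simp add: seg_weight_def)
    next
      case 2
      then show ?thesis
        using end_bound[OF dist, of "hd (qs ! k)" f] ne assms(3) by (simp add: seg_weight_def)
    next
      case 3
      then show ?thesis
        using middle_bound[OF dist ne even[OF 3], of f] assms(3) by (simp add: seg_weight_def)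
    qed
  qed
  finally show ?thesis .
qed

text \<open>
  A segment of weight \<open>c / d\<close>, with \<open>d\<close> vertices, has \<open>c\<close> ends at cut edges; hence it contributes
  \<open>c\<^sup>2 / d\<close> to both sides.
\<close>

lemma cut_energy_eq_jumps:
  assumes "[] \<notin> set qs" and "length qs = Suc s" and "s \<ge> 1"
  shows "(\<Sum>k<s. seg_weight qs k + seg_weight qs (Suc k)) = cut_energy qs"
proof -
  have "(if k < s then seg_weight qs k else 0) + (if 0 < k then seg_weight qs k else 0) =
      real (length (qs ! k)) * (seg_weight qs k)\<^sup>2" if "k < Suc s" for k
  proof -
    have "qs ! k \<noteq> []" using assms(1,2) that nth_mem by metis
    then show ?thesis
      using that assms(2,3) by (auto simp: seg_weight_def power2_eq_square)
  qed
  then show ?thesis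
    unfolding sum_consecutive cut_energy_def assms(2) by (intro sum.cong) auto
qed

lemma cut_energy_pos:
  assumes "[] \<notin> set qs" and "qs \<noteq> []"
  shows "cut_energy qs > 0"
  unfolding cut_energy_def
proof (rule sum_pos)
  fix k assume "k \<in> {..<length qs}"
  then have "qs ! k \<noteq> []" using assms(1) nth_mem by (metis lessThan_iff)
  then show "0 < real (length (qs ! k)) * (seg_weight qs k)\<^sup>2"
    by (auto simp: seg_weight_def)
qed (use assms in auto)

lemma cut_energy_formula:
  assumes "[] \<notin> set qs" and "length qs = Suc s" and "s \<ge> 1"
    and d: "\<And>k. k \<le> s \<Longrightarrow> d (Suc k) = length (qs ! k)"
  shows "cut_energy qs = 1 / real (d 1) + (\<Sum>j=2..s. 4 / real (d j)) + 1 / real (d (s + 1))"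
proof -
  have ne: "qs ! k \<noteq> []" if "k \<le> s" for k using assms(1,2) that nth_mem by (metis le_imp_less_Suc)
  let ?t = "\<lambda>k. real (length (qs ! k)) * (seg_weight qs k)\<^sup>2"
  obtain r where s: "s = Suc r" using assms(3) by (cases s) auto
  have t: "?t k = (if k = 0 \<or> k = s then 1 else 4) / real (d (Suc k))" if "k \<le> s" for k
    using d[OF that] ne[OF that] assms(2) by (auto simp: seg_weight_def power2_eq_square)
  have "cut_energy qs = (\<Sum>k<Suc s. (if k = 0 \<or> k = s then 1 else 4) / real (d (Suc k)))"
    unfolding cut_energy_def assms(2) using t by (intro sum.cong) auto
  also have "\<dots> = (\<Sum>k<s. (if k = 0 then 1 else 4) / real (d (Suc k))) + 1 / real (d (Suc s))"
    by simp
  also have "(\<Sum>k<s. (if k = 0 then 1 else 4) / real (d (Suc k)))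
      = 1 / real (d 1) + (\<Sum>k<r. 4 / real (d (k + 2)))"
    unfolding s by (simp add: sum.lessThan_Suc_shift del: sum.lessThan_Suc)
  also have "(\<Sum>k<r. 4 / real (d (k + 2))) = (\<Sum>j=2..s. 4 / real (d j))"
    unfolding s by (rule sum.reindex_bij_witness[of _ "\<lambda>j. j - 2" "\<lambda>k. k + 2"]) auto
  finally show ?thesis by simp
qed

text \<open>
  A function that rises by at most one between consecutive segments needs all \<open>s\<close> transitions to get
  from \<open>0\<close> to \<open>s\<close>, so it rises at every one of them. It suffices to know one of these two values at
  the corresponding end of the path: then the vertex where the other value is found comes in the
  right order.
\<close>

lemma segment_levels:
  fixes c :: "'a \<Rightarrow> nat"
  assumes len: "length qs = Suc s" and ne: "[] \<notin> set qs"
    and const: "\<And>q u v. q \<in> set qs \<Longrightarrow> u \<in> set q \<Longrightarrow> v \<in> set q \<Longrightarrow> c u = c v"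
    and step: "\<And>k. k < s \<Longrightarrow> c (hd (qs ! Suc k)) \<le> Suc (c (last (qs ! k)))"
    and u: "u \<in> set (concat qs)" "c u = 0" and w: "w \<in> set (concat qs)" "c w = s"
    and ends: "u = hd (concat qs) \<or> w = last (concat qs)"
    and k: "k \<le> s" and v: "v \<in> set (qs ! k)"
  shows "c v = k"
proof -
  define l where "l j = c (hd (qs ! j))" for j
  have mem: "qs ! j \<in> set qs" if "j \<le> s" for j using that len by simp
  have nonempty: "qs ! j \<noteq> []" if "j \<le> s" for j using mem[OF that] ne by metis
  have l: "c x = l j" if "j \<le> s" "x \<in> set (qs ! j)" for x j
    unfolding l_def using const[OF mem[OF that(1)] that(2)] nonempty[OF that(1)] by simp
  have lstep: "l (Suc j) \<le> Suc (l j)" if "j < s" for j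
    using step[OF that] l[of j "last (qs ! j)"] nonempty[of j] that by (simp add: l_def)
  have climb: "l j \<le> l i + (j - i)" if "i \<le> j" "j \<le> s" for i j
    using that
  proof (induction j rule: dec_induct)
    case (step j)
    then show ?case using lstep[of j] by simp
  qed simp
  have index: "\<exists>j\<le>s. x \<in> set (qs ! j)" if "x \<in> set (concat qs)" for x
  proof -
    obtain q where "q \<in> set qs" "x \<in> set q" using \<open>x \<in> set (concat qs)\<close> by auto
    then show ?thesis using len by (metis in_set_conv_nth less_Suc_eq_le)
  qed
  obtain i where i: "i \<le> s" "l i = 0" "u = hd (concat qs) \<longrightarrow> i = 0"
  proof (cases "u = hd (concat qs)")
    case True
    have "u = hd (qs ! 0)" using True len nonempty[of 0] by (cases qs) auto
    then show ?thesis using that[of 0] u(2) by (simp add: l_def)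
  next
    case False
    obtain i where "i \<le> s" "u \<in> set (qs ! i)" using index[OF u(1)] by blast
    then show ?thesis using that[of i] l[of i u] u(2) False by simp
  qed
  obtain j where j: "j \<le> s" "l j = s" "w = last (concat qs) \<longrightarrow> j = s"
  proof (cases "w = last (concat qs)")
    case True
    obtain r q where qs: "qs = r @ [q]" using len by (cases qs rule: rev_cases) auto
    then have "qs ! s = q" using len by (simp add: nth_append)
    then have "w = last (qs ! s)" using True qs nonempty[of s] by simp
    then show ?thesis using that[of s] w(2) l[of s w] nonempty[of s] by simp
  next
    case False
    obtain j where "j \<le> s" "w \<in> set (qs ! j)" using index[OF w(1)] by blast
    then show ?thesis using that[of j] l[of j w] w(2) False by simp
  qed
  have "i \<le> j" using i j ends by auto
  then have "i = 0" "j = s" using climb[of i j] i j by auto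
  then have "l k = k" using climb[of 0 k] climb[of k s] i j k by auto
  then show ?thesis using l[OF k v] by simp
qed

section \<open>The branched path graph as a rooted tree\<close>

locale branched_path =
  fixes n1 n2 b :: nat
  assumes b_pos: "1 \<le> b" and b_less: "b < n1"
begin

abbreviation "n \<equiv> n1 + n2"
abbreviation "V \<equiv> bp_vertices n1 n2"
abbreviation "E \<equiv> bp_edges n1 n2 b"
abbreviation "par \<equiv> bp_parent n1 b"
abbreviation "edge \<equiv> bp_edge n1 b"

lemma par_bounds: "2 \<le> i \<Longrightarrow> 1 \<le> par i \<and> par i < i"
  using b_pos b_less by (auto simp: bp_parent_def)

lemma inj_edge: "inj_on edge {2..}"
proof (rule inj_onI)
  fix i j assume "i \<in> {2..}" "j \<in> {2..}" "edge i = edge j"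
  moreover have "Max (edge k) = k" if "k \<in> {2..}" for k
    using par_bounds[of k] that by (simp add: bp_edge_def)
  ultimately show "i = j" by metis
qed

lemma edge_jump_edge: "edge_jump f (edge i) = \<bar>f i - f (par i)\<bar>"
  by (simp add: bp_edge_def abs_minus_commute)

lemma in_E_iff: "{x, y} \<in> E \<longleftrightarrow> (\<exists>i\<in>{2..n}. x = par i \<and> y = i \<or> x = i \<and> y = par i)"
proof -
  have "{x, y} \<in> E \<longleftrightarrow> (\<exists>i\<in>{2..n}. {x, y} = {par i, i})"
    unfolding bp_edges_def bp_edge_def by (rule image_iff)
  then show ?thesis by (simp only: doubleton_eq_iff)
qed

text \<open>The vertices on the path from the root to \<open>i\<close>.\<close>

definition ancestors :: "nat \<Rightarrow> nat set" where
  "ancestors i = (if i \<le> n1 then {1..i} else {1..b} \<union> {n1 + 1..i})"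

lemma finite_ancestors [simp]: "finite (ancestors i)"
  by (simp add: ancestors_def)

lemma ancestors_1 [simp]: "ancestors (Suc 0) = {1}"
  using b_pos b_less by (auto simp: ancestors_def)

lemma ancestors_step:
  assumes "2 \<le> i"
  shows "ancestors i = insert i (ancestors (par i))" and "i \<notin> ancestors (par i)"
proof -
  consider "i \<le> n1" | "i = n1 + 1" | "i > n1 + 1" by linarith
  then have "ancestors i = insert i (ancestors (par i)) \<and> i \<notin> ancestors (par i)"
    using assms b_pos b_less
    by cases (auto simp: ancestors_def bp_parent_def)
  then show "ancestors i = insert i (ancestors (par i))" "i \<notin> ancestors (par i)" by auto
qed

text \<open>
  A path that starts at the root moves away from the root in every step, since otherwise it would
  return to the vertex it came from. So its vertices are determined by its last one, which makes the
  path matrix the incidence matrix of the ancestor relation.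
\<close>

lemma root_path_step:
  assumes "is_path V E p" and "hd p = 1"
  shows "set p = ancestors (last p) \<and>
    (butlast p \<noteq> [] \<longrightarrow> last (butlast p) = par (last p))"
  using assms
proof (induction p rule: rev_induct)
  case (snoc x p)
  show ?case
  proof (cases "p = []")
    case True
    then show ?thesis using snoc.prems by simp
  next
    case False
    have pe: "path_edges (p @ [x]) = insert {last p, x} (path_edges p)"
      using path_edges_append[OF False, of "[x]"] by simp
    have path: "is_path V E p" and hd: "hd p = 1" and x: "x \<notin> set p" and "{last p, x} \<in> E"
      using snoc.prems False pe by (auto simp: is_path_def)
    note IH = snoc.IH[OF path hd]
    obtain i where i: "i \<in> {2..n}" "last p = par i \<and> x = i \<or> last p = i \<and> x = par i"
      using \<open>{last p, x} \<in> E\<close> in_E_iff by auto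
    \<comment> \<open>The path cannot turn back towards the root: its last step already came from there.\<close>
    have "\<not> (last p = i \<and> x = par i)"
    proof
      assume a: "last p = i \<and> x = par i"
      obtain q y where p: "p = q @ [y]" using False by (cases p rule: rev_cases) auto
      have "q \<noteq> []" using a hd i(1) p by auto
      then have "last q = x" using IH a p by simp
      then show False using x p \<open>q \<noteq> []\<close> by auto
    qed
    then show ?thesis using i IH ancestors_step[of i] by auto
  qed
qed (simp add: is_path_def)

lemma root_path_exists:
  assumes "i \<in> {1..n}"
  shows "\<exists>p. is_path V E p \<and> hd p = 1 \<and> last p = i"
  using assms
proof (induction i rule: less_induct)
  case (less i)
  show ?case
  proof (cases "i = 1")
    case True
    then show ?thesis using less.prems
      by (intro exI[of _ "[1]"]) (auto simp: is_path_def bp_vertices_def)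
  next
    case False
    then have i: "2 \<le> i" "i \<le> n" using less.prems by auto
    then obtain p where p: "is_path V E p" "hd p = 1" "last p = par i"
      using less.IH[of "par i"] par_bounds[of i] by auto
    have ne: "p \<noteq> []" using p by (simp add: is_path_def)
    have "{par i, i} \<in> E" using i in_E_iff by auto
    moreover have "i \<notin> set p"
      using root_path_step[OF p(1,2)] p(3) ancestors_step(2)[OF i(1)] by simp
    ultimately have "is_path V E (p @ [i])"
      using p ne i path_edges_append[OF ne, of "[i]"] by (auto simp: is_path_def bp_vertices_def)
    then show ?thesis using p(2) ne by (intro exI[of _ "p @ [i]"]) simp
  qed
qed

lemma path_matrix_eq:
  assumes "i \<in> {1..n}"
  shows "path_matrix n1 n2 b i j = (if j \<in> ancestors i then 1 else 0)"
proof -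
  have "(\<exists>p. is_path V E p \<and> hd p = 1 \<and> last p = i \<and> j \<in> set p) \<longleftrightarrow> j \<in> ancestors i"
    using root_path_step root_path_exists[OF assms] by metis
  then show ?thesis by (simp add: path_matrix_def)
qed

lemma mat_vec_eq:
  assumes "i \<in> {1..n}"
  shows "mat_vec n (path_matrix n1 n2 b) \<beta> i = (\<Sum>j\<in>ancestors i. \<beta> j)"
proof -
  have sub: "ancestors i \<subseteq> {1..n}" using assms b_less by (auto simp: ancestors_def)
  have "mat_vec n (path_matrix n1 n2 b) \<beta> i = (\<Sum>j=1..n. if j \<in> ancestors i then \<beta> j else 0)"
    unfolding mat_vec_def using path_matrix_eq[OF assms] by (intro sum.cong) auto
  also have "\<dots> = (\<Sum>j\<in>{1..n} \<inter> ancestors i. \<beta> j)" by (simp add: sum.inter_restrict)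
  also have "{1..n} \<inter> ancestors i = ancestors i" using sub by blast
  finally show ?thesis .
qed

lemma mat_vec_step:
  assumes "i \<in> {2..n}"
  shows "mat_vec n (path_matrix n1 n2 b) \<beta> i - mat_vec n (path_matrix n1 n2 b) \<beta> (par i) = \<beta> i"
  using assms par_bounds[of i] ancestors_step[of i] by (simp add: mat_vec_eq)

text \<open>The coefficient vector \<open>\<beta>\<close> with \<open>X \<beta> = f\<close>; the root has no parent, so its increment is \<open>f 1\<close>.\<close>

definition increments :: "(nat \<Rightarrow> real) \<Rightarrow> nat \<Rightarrow> real" where
  "increments f i = (if i \<le> 1 then f i else f i - f (par i))"

lemma mat_vec_increments:
  assumes "i \<in> {1..n}"
  shows "mat_vec n (path_matrix n1 n2 b) (increments f) i = f i"
  using assms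
proof (induction i rule: less_induct)
  case (less i)
  show ?case
  proof (cases "i = 1")
    case True
    then show ?thesis using less.prems by (simp add: mat_vec_eq increments_def)
  next
    case False
    then have i: "i \<in> {2..n}" using less.prems by auto
    have "mat_vec n (path_matrix n1 n2 b) (increments f) (par i) = f (par i)"
      using less.IH[of "par i"] par_bounds[of i] i by auto
    then show ?thesis
      using mat_vec_step[OF i, of "increments f"] i increments_def[of f i] by simp
  qed
qed

text \<open>
  The number of edges of \<open>A\<close> between the root and \<open>v\<close>. Edges outside \<open>A\<close> do not change it, which is
  how the position of a vertex is traced along paths of any direction.
\<close>

definition level :: "nat set \<Rightarrow> nat \<Rightarrow> nat" where
  "level A v = card (A \<inter> ancestors v)"

lemma level_step:
  "2 \<le> v \<Longrightarrow> level A v = level A (par v) + (if v \<in> A then 1 else 0)"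
  using ancestors_step[of v] by (simp add: level_def Int_insert_right)

lemma level_edge_le:
  assumes "{x, y} \<in> E"
  shows "level A x \<le> Suc (level A y)"
proof -
  obtain i where i: "2 \<le> i" "x = par i \<and> y = i \<or> x = i \<and> y = par i"
    using assms in_E_iff by auto
  have "level A i \<le> Suc (level A (par i))" "level A (par i) \<le> Suc (level A i)"
    using level_step[OF i(1), of A] by simp_all
  then show ?thesis using i(2) by metis
qed

lemma level_edge_eq:
  assumes "{x, y} \<in> E" and "\<And>k. k \<in> A \<Longrightarrow> edge k \<noteq> {x, y}"
  shows "level A x = level A y"
proof -
  obtain i where i: "2 \<le> i" "x = par i \<and> y = i \<or> x = i \<and> y = par i"
    using assms(1) in_E_iff by auto
  then have "edge i = {x, y}" by (auto simp: bp_edge_def)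
  then have "i \<notin> A" using assms(2) by blast
  then have "level A i = level A (par i)" using level_step[OF i(1), of A] by simp
  then show ?thesis using i(2) by metis
qed

end

section \<open>Decompositions into three cut paths\<close>

text \<open>
  The list \<open>Q i\<close> holds the segments of \<open>P i\<close>, and segments are counted from \<open>0\<close> to \<open>s i\<close>. The deleted
  edges do not appear: they are the edges that belong to none of the paths.
\<close>

locale branch_decomposition = branched_path +
  fixes S :: "nat set" and P :: "nat \<Rightarrow> nat list" and s :: "nat \<Rightarrow> nat"
    and Q :: "nat \<Rightarrow> nat list list"
  assumes S_subset: "S \<subseteq> {2..n1 + n2}"
    and path: "i \<in> {1,2,3} \<Longrightarrow> is_path (bp_vertices n1 n2) (bp_edges n1 n2 b) (P i)"
    and cover: "(\<Union>i\<in>{1,2,3}. set (P i)) = bp_vertices n1 n2"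
    and disjoint: "i \<in> {1,2,3} \<Longrightarrow> j \<in> {1,2,3} \<Longrightarrow> i \<noteq> j \<Longrightarrow> set (P i) \<inter> set (P j) = {}"
    and hd_1: "hd (P 1) = 1" and last_2: "last (P 2) = n1" and last_3: "last (P 3) = n1 + n2"
    and s_eq: "i \<in> {1,2,3} \<Longrightarrow> card (S_part n1 n2 b S i) = s i"
    and s_pos: "i \<in> {1,2,3} \<Longrightarrow> s i \<ge> 1"
    and own: "i \<in> {1,2,3} \<Longrightarrow> {k \<in> S. bp_edge n1 b k \<in> path_edges (P i)} = S_part n1 n2 b S i"
    and cuts: "i \<in> {1,2,3} \<Longrightarrow> cuts_into (bp_edge n1 b ` S_part n1 n2 b S i) (P i) (Q i)"
    and length_Q: "i \<in> {1,2,3} \<Longrightarrow> length (Q i) = Suc (s i)"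
    and even_Q: "i \<in> {1,2,3} \<Longrightarrow> 0 < k \<Longrightarrow> k < s i \<Longrightarrow> even (length (Q i ! k))"
    and balanced: "length (Q 1 ! s 1) = length (Q 2 ! 0)" "length (Q 2 ! 0) = length (Q 3 ! 0)"
begin

abbreviation "part \<equiv> S_part n1 n2 b S"

lemma finite_S [simp]: "finite S"
  using S_subset finite_subset by blast

lemma finite_part [simp]: "finite (part i)"
  by (simp add: S_part_def)

lemma part_cover: "S = part 1 \<union> part 2 \<union> part 3"
  using S_subset b_less by (auto simp: S_part_def)

lemma part_disjoint: "i \<in> {1,2,3} \<Longrightarrow> j \<in> {1,2,3} \<Longrightarrow> i \<noteq> j \<Longrightarrow> part i \<inter> part j = {}"
  using b_less by (auto simp: S_part_def split: if_splits)

lemma part_subset: "part i \<subseteq> S" "part i \<subseteq> {2..n}"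
  using S_subset by (auto simp: S_part_def)

lemma Q_facts:
  assumes "i \<in> {1,2,3}"
  shows "concat (Q i) = P i" and "[] \<notin> set (Q i)" and "distinct (concat (Q i))"
    and "(\<Union>q\<in>set (Q i). path_edges q) = path_edges (P i) - edge ` part i"
    and "path_edges (P i) \<subseteq> E" and "P i \<noteq> []"
  using path[OF assms] cuts[OF assms] by (auto simp: cuts_into_def is_path_def)

lemma Q_nonempty:
  assumes "i \<in> {1,2,3}" and "k \<le> s i"
  shows "Q i ! k \<noteq> []" and "Q i ! k \<in> set (Q i)"
proof -
  show "Q i ! k \<in> set (Q i)" using length_Q[OF assms(1)] assms(2) by simp
  then show "Q i ! k \<noteq> []" using Q_facts(2)[OF assms(1)] by metis
qed

lemma part_edges: "i \<in> {1,2,3} \<Longrightarrow> edge ` part i \<subseteq> path_edges (P i)"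
  using own by blast

lemma edge_ends_in_path:
  assumes "i \<in> {1,2,3}" and "k \<in> part i"
  shows "k \<in> set (P i)" and "par k \<in> set (P i)"
proof -
  have "edge k \<in> path_edges (P i)" using part_edges[OF assms(1)] assms(2) by blast
  then have "edge k \<subseteq> set (P i)" by (rule path_edges_subset)
  then show "k \<in> set (P i)" "par k \<in> set (P i)" by (auto simp: bp_edge_def)
qed

lemma sum_over_S:
  fixes h :: "nat \<Rightarrow> real"
  shows "(\<Sum>k\<in>S. h k) = (\<Sum>i\<in>{1,2,3}. \<Sum>k\<in>part i. h k)"
proof -
  have S: "S = (\<Union>i\<in>{1,2,3}. part i)" using part_cover by auto
  have "(\<Sum>k\<in>(\<Union>i\<in>{1,2,3}. part i). h k) = (\<Sum>i\<in>{1,2,3}. \<Sum>k\<in>part i. h k)"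
    by (rule sum.UNION_disjoint) (use part_disjoint in auto)
  then show ?thesis using S by metis
qed

lemma sum_over_vertices:
  fixes h :: "nat \<Rightarrow> real"
  shows "(\<Sum>v=1..n. h v) = (\<Sum>i\<in>{1,2,3}. \<Sum>k<Suc (s i). \<Sum>v\<in>set (Q i ! k). h v)"
proof -
  have "(\<Sum>v\<in>(\<Union>i\<in>{1,2,3}. set (P i)). h v) = (\<Sum>i\<in>{1,2,3}. \<Sum>v\<in>set (P i). h v)"
    by (rule sum.UNION_disjoint) (use disjoint in auto)
  then have "(\<Sum>v=1..n. h v) = (\<Sum>i\<in>{1,2,3}. \<Sum>v\<in>set (P i). h v)"
    using cover by (simp only: bp_vertices_def)
  also have "\<dots> = (\<Sum>i\<in>{1,2,3}. \<Sum>k<Suc (s i). \<Sum>v\<in>set (Q i ! k). h v)"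
  proof (rule sum.cong[OF refl])
    fix i :: nat assume i: "i \<in> {1,2,3}"
    show "(\<Sum>v\<in>set (P i). h v) = (\<Sum>k<Suc (s i). \<Sum>v\<in>set (Q i ! k). h v)"
      using sum_segments[OF Q_facts(3)[OF i], of h] Q_facts(1)[OF i] length_Q[OF i] by simp
  qed
  finally show ?thesis .
qed

lemma sum_over_part:
  fixes f :: "nat \<Rightarrow> real"
  assumes "i \<in> {1,2,3}"
  shows "(\<Sum>k\<in>part i. \<bar>f k - f (par k)\<bar>) =
    (\<Sum>k<s i. \<bar>f (last (Q i ! k)) - f (hd (Q i ! Suc k))\<bar>)"
proof -
  have "inj_on edge (part i)" using inj_edge part_subset(2)[of i] by (force intro: inj_on_subset)
  then have "(\<Sum>e\<in>edge ` part i. edge_jump f e) = (\<Sum>k\<in>part i. \<bar>f k - f (par k)\<bar>)"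
    by (simp add: sum.reindex edge_jump_edge)
  then show ?thesis
    using sum_edge_jump_cut(1)[OF cuts[OF assms] _ part_edges[OF assms] length_Q[OF assms], of f]
      path[OF assms] by (simp add: is_path_def)
qed

text \<open>
  The inequality drops the jumps over the two deleted edges, which lie outside \<open>S\<close> and in none of
  the paths.
\<close>

lemma variation_le_non_S:
  "(\<Sum>i\<in>{1,2,3}. \<Sum>k<Suc (s i). variation f (Q i ! k))
    \<le> (\<Sum>k\<in>{1..n} - ({1} \<union> S). \<bar>f k - f (par k)\<bar>)"
proof -
  let ?R = "\<lambda>i. path_edges (P i) - edge ` part i"
  let ?N = "{1..n} - ({1} \<union> S)"
  have "(\<Sum>i\<in>{1,2,3}. \<Sum>k<Suc (s i). variation f (Q i ! k))
      = (\<Sum>i\<in>{1,2,3}. \<Sum>e\<in>?R i. edge_jump f e)"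
  proof (rule sum.cong[OF refl])
    fix i :: nat assume i: "i \<in> {1,2,3}"
    show "(\<Sum>k<Suc (s i). variation f (Q i ! k)) = (\<Sum>e\<in>?R i. edge_jump f e)"
      using sum_edge_jump_cut(2)[OF cuts[OF i] _ part_edges[OF i] length_Q[OF i], of f] path[OF i]
      by (simp add: is_path_def)
  qed
  also have "\<dots> = (\<Sum>e\<in>(\<Union>i\<in>{1,2,3}. ?R i). edge_jump f e)"
  proof (rule sum.UNION_disjoint[symmetric])
    show "\<forall>i\<in>{1,2,3}. \<forall>j\<in>{1,2,3}. i \<noteq> j \<longrightarrow> ?R i \<inter> ?R j = {}"
      using path_edges_disjoint[OF disjoint] by blast
  qed auto
  also have "\<dots> \<le> (\<Sum>e\<in>edge ` ?N. edge_jump f e)"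
  proof (rule sum_mono2)
    show "(\<Union>i\<in>{1,2,3}. ?R i) \<subseteq> edge ` ?N"
    proof
      fix e assume "e \<in> (\<Union>i\<in>{1,2,3}. ?R i)"
      then obtain i where i: "i \<in> {1,2,3}" and e: "e \<in> path_edges (P i)" "e \<notin> edge ` part i"
        by blast
      obtain k where k: "k \<in> {2..n}" "e = edge k"
        using Q_facts(5)[OF i] e(1) by (auto simp: bp_edges_def)
      have "k \<notin> S" using own[OF i] e k(2) by blast
      then show "e \<in> edge ` ?N" using k by auto
    qed
  qed auto
  also have "\<dots> = (\<Sum>k\<in>?N. \<bar>f k - f (par k)\<bar>)"
  proof -
    have "inj_on edge ?N" by (rule inj_on_subset[OF inj_edge]) auto
    then show ?thesis by (simp add: sum.reindex edge_jump_edge)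
  qed
  finally show ?thesis .
qed

definition excess :: "(nat \<Rightarrow> real) \<Rightarrow> real" where
  "excess f = (\<Sum>k\<in>S. \<bar>f k - f (par k)\<bar>) - (\<Sum>k\<in>{1..n} - ({1} \<union> S). \<bar>f k - f (par k)\<bar>)"

definition energy :: real where
  "energy = (\<Sum>i\<in>{1,2,3}. cut_energy (Q i))"

lemma energy_pos: "energy > 0"
  unfolding energy_def
proof (rule sum_pos)
  fix i :: nat assume i: "i \<in> {1,2,3}"
  have "Q i \<noteq> []" using length_Q[OF i] by auto
  then show "0 < cut_energy (Q i)" by (rule cut_energy_pos[OF Q_facts(2)[OF i]])
qed auto

lemma excess_le:
  "excess f \<le> (\<Sum>i\<in>{1,2,3}. \<Sum>k<Suc (s i). \<Sum>v\<in>set (Q i ! k). seg_weight (Q i) k * \<bar>f v\<bar>)"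
proof -
  have "excess f \<le> (\<Sum>i\<in>{1,2,3}. \<Sum>k\<in>part i. \<bar>f k - f (par k)\<bar>)
      - (\<Sum>i\<in>{1,2,3}. \<Sum>k<Suc (s i). variation f (Q i ! k))"
    unfolding excess_def sum_over_S using variation_le_non_S[of f] by linarith
  also have "\<dots> = (\<Sum>i\<in>{1,2,3}. (\<Sum>k\<in>part i. \<bar>f k - f (par k)\<bar>)
      - (\<Sum>k<Suc (s i). variation f (Q i ! k)))"
    by (simp only: sum_subtractf)
  also have "\<dots> \<le> (\<Sum>i\<in>{1,2,3}. \<Sum>k<Suc (s i). seg_weight (Q i) k * (\<Sum>v\<in>set (Q i ! k). \<bar>f v\<bar>))"
  proof (rule sum_mono)
    fix i :: nat assume i: "i \<in> {1,2,3}"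
    show "(\<Sum>k\<in>part i. \<bar>f k - f (par k)\<bar>) - (\<Sum>k<Suc (s i). variation f (Q i ! k))
        \<le> (\<Sum>k<Suc (s i). seg_weight (Q i) k * (\<Sum>v\<in>set (Q i ! k). \<bar>f v\<bar>))"
      unfolding sum_over_part[OF i]
      by (rule cut_path_bound[OF Q_facts(3)[OF i] Q_facts(2)[OF i] length_Q[OF i] s_pos[OF i]
            even_Q[OF i]])
  qed
  finally show ?thesis by (simp only: sum_distrib_left)
qed

lemma sum_weights_sq:
  "(\<Sum>i\<in>{1,2,3}. \<Sum>k<Suc (s i). \<Sum>v\<in>set (Q i ! k). (seg_weight (Q i) k)\<^sup>2) = energy"
  unfolding energy_def
proof (rule sum.cong[OF refl])
  fix i :: nat assume i: "i \<in> {1,2,3}"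
  have "distinct (Q i ! k)" if "k < Suc (s i)" for k
    using Q_facts(3)[OF i] Q_nonempty(2)[OF i, of k] that by (simp add: distinct_concat_iff)
  then show "(\<Sum>k<Suc (s i). \<Sum>v\<in>set (Q i ! k). (seg_weight (Q i) k)\<^sup>2) = cut_energy (Q i)"
    unfolding cut_energy_def length_Q[OF i] by (intro sum.cong) (auto simp: distinct_card)
qed

text \<open>
  Expanding \<open>(energy * \<bar>f v\<bar> - w)\<^sup>2 \<ge> 0\<close> at each vertex of weight \<open>w\<close> replaces the Cauchy-Schwarz
  inequality; it is an equality for \<open>\<bar>f v\<bar> = w / energy\<close>, the extremal values.
\<close>

lemma norm_bound:
  assumes "excess f = 1"
  shows "1 / energy \<le> (\<Sum>v=1..n. (f v)\<^sup>2)"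
proof -
  let ?\<Sigma> = "\<lambda>h. \<Sum>i\<in>{1,2,3}. \<Sum>k<Suc (s i). \<Sum>v\<in>set (Q i ! k). (h i k v :: real)"
  have "2 * energy * 1 \<le> 2 * energy * ?\<Sigma> (\<lambda>i k v. seg_weight (Q i) k * \<bar>f v\<bar>)"
    using excess_le[of f] assms energy_pos by (intro mult_left_mono) auto
  also have "\<dots> = ?\<Sigma> (\<lambda>i k v. 2 * energy * (seg_weight (Q i) k * \<bar>f v\<bar>))"
    by (simp only: sum_distrib_left)
  also have "\<dots> \<le> ?\<Sigma> (\<lambda>i k v. energy\<^sup>2 * (f v)\<^sup>2 + (seg_weight (Q i) k)\<^sup>2)"
  proof (intro sum_mono)
    fix i k v
    have "0 \<le> (energy * \<bar>f v\<bar> - seg_weight (Q i) k)\<^sup>2" by simp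
    then show "2 * energy * (seg_weight (Q i) k * \<bar>f v\<bar>)
        \<le> energy\<^sup>2 * (f v)\<^sup>2 + (seg_weight (Q i) k)\<^sup>2"
      by (simp add: power2_diff algebra_simps)
  qed
  also have "\<dots> = energy\<^sup>2 * (\<Sum>v=1..n. (f v)\<^sup>2) + energy"
    by (simp only: sum.distrib sum_over_vertices sum_weights_sq sum_distrib_left)
  finally have "energy * 1 \<le> energy * (energy * (\<Sum>v=1..n. (f v)\<^sup>2))"
    by (simp add: power2_eq_square)
  then have "1 \<le> energy * (\<Sum>v=1..n. (f v)\<^sup>2)"
    using energy_pos by (simp only: mult_le_cancel_left_pos)
  then show ?thesis using energy_pos by (simp add: field_simps)
qed

section \<open>Levels of the segments\<close>

lemma level_other_part:
  assumes "i \<in> {1,2,3}" and "j \<in> {1,2,3}" and "i \<noteq> j" and "u \<in> set (P i)" and "v \<in> set (P i)"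
  shows "level (part j) u = level (part j) v"
proof (rule constant_on_path[OF _ assms(4,5)])
  fix x y assume xy: "{x, y} \<in> path_edges (P i)"
  show "level (part j) x = level (part j) y"
  proof (rule level_edge_eq)
    show "{x, y} \<in> E" using xy Q_facts(5)[OF assms(1)] by blast
    show "edge k \<noteq> {x, y}" if "k \<in> part j" for k
    proof
      assume "edge k = {x, y}"
      then have "k \<in> part i" using that xy own[OF assms(1)] part_subset(1)[of j] by auto
      then show False using that part_disjoint[OF assms(1-3)] by blast
    qed
  qed
qed

lemma anchors: "1 \<in> set (P 1)" "n1 \<in> set (P 2)" "n \<in> set (P 3)"
proof -
  have "P 1 \<noteq> []" "P 2 \<noteq> []" "P 3 \<noteq> []" using Q_facts(6) by simp_all
  then show "1 \<in> set (P 1)" "n1 \<in> set (P 2)" "n \<in> set (P 3)"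
    using hd_in_set last_in_set hd_1 last_2 last_3 by metis+
qed

lemma n2_pos: "n2 > 0"
  using s_eq[of 3] s_pos[of 3] by (cases n2) (auto simp: S_part_def)

lemma level_root: "level (part j) 1 = 0"
  using part_subset(2)[of j] by (fastforce simp: level_def)

lemma level_n1: "level (part 1) n1 = s 1" "level (part 2) n1 = s 2" "level (part 3) n1 = 0"
proof -
  have "part 1 \<inter> ancestors n1 = part 1" "part 2 \<inter> ancestors n1 = part 2"
    "part 3 \<inter> ancestors n1 = {}"
    using b_less b_pos by (auto simp: S_part_def ancestors_def)
  then show "level (part 1) n1 = s 1" "level (part 2) n1 = s 2" "level (part 3) n1 = 0"
    using s_eq by (simp_all add: level_def)
qed

lemma level_n: "level (part 1) n = s 1" "level (part 2) n = 0" "level (part 3) n = s 3"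
proof -
  have "part 1 \<inter> ancestors n = part 1" "part 2 \<inter> ancestors n = {}"
    "part 3 \<inter> ancestors n = part 3"
    using b_less b_pos n2_pos by (auto simp: S_part_def ancestors_def)
  then show "level (part 1) n = s 1" "level (part 2) n = 0" "level (part 3) n = s 3"
    using s_eq by (simp_all add: level_def)
qed

text \<open>
  Each path has one of the two extreme levels at its fixed end: \<open>P 1\<close> starts at the root, \<open>P 2\<close> and
  \<open>P 3\<close> end at leaves. The other one is found at the cut edge farthest from this end: below the last
  edge of \<open>S\<^sub>1\<close>, or above the first edge of \<open>S\<^sub>2\<close> or \<open>S\<^sub>3\<close>.
\<close>

lemma level_extremes:
  assumes "i \<in> {1,2,3}"
  shows "\<exists>u w. u \<in> set (P i) \<and> w \<in> set (P i) \<and> level (part i) u = 0 \<and> level (part i) w = s i \<and>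
    (u = hd (P i) \<or> w = last (P i))"
proof -
  have ne: "part i \<noteq> {}" using s_eq[OF assms] s_pos[OF assms] by auto
  have below: "level (part i) (par (Min (part i))) = 0"
    if "part i \<inter> ancestors (Min (part i)) = {Min (part i)}"
  proof -
    have m: "Min (part i) \<in> part i" using ne by simp
    then have "2 \<le> Min (part i)" using part_subset(2)[of i] by fastforce
    then show ?thesis using level_step[of "Min (part i)" "part i"] that m by (simp add: level_def)
  qed
  consider "i = 1" | "i = 2" | "i = 3" using assms by blast
  then show ?thesis
  proof cases
    case 1
    have m: "Max (part 1) \<in> part 1" using ne 1 by simp
    then have "part 1 \<inter> ancestors (Max (part 1)) = part 1"
      using b_less Max_ge[OF finite_part[of 1]] by (fastforce simp: S_part_def ancestors_def)
    then have "level (part 1) (Max (part 1)) = s 1" using s_eq[of 1] by (simp add: level_def)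
    then show ?thesis
      using 1 m edge_ends_in_path(1)[of 1 "Max (part 1)"] anchors(1) level_root[of 1] hd_1
      by (intro exI[of _ 1] exI[of _ "Max (part 1)"]) simp
  next
    case 2
    have m: "Min (part 2) \<in> part 2" using ne 2 by simp
    then have "Min (part 2) \<le> n1" "1 \<le> Min (part 2)" by (auto simp: S_part_def)
    then have "part 2 \<inter> ancestors (Min (part 2)) = {Min (part 2)}"
      using m Min_le[OF finite_part[of 2]] by (auto simp: ancestors_def intro: antisym)
    then show ?thesis
      using 2 m below edge_ends_in_path(2)[of 2 "Min (part 2)"] anchors(2) level_n1(2) last_2
      by (intro exI[of _ "par (Min (part 2))"] exI[of _ "n1"]) simp
  next
    case 3
    have m: "Min (part 3) \<in> part 3" using ne 3 by simp
    then have "Min (part 3) > n1" by (auto simp: S_part_def)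
    moreover have "part 3 \<inter> {1..b} = {}" using b_less by (auto simp: S_part_def)
    ultimately have "part 3 \<inter> ancestors (Min (part 3)) = {Min (part 3)}"
      using m Min_le[OF finite_part[of 3]] by (auto simp: ancestors_def intro: antisym)
    then show ?thesis
      using 3 m below edge_ends_in_path(2)[of 3 "Min (part 3)"] anchors(3) level_n(3) last_3
      by (intro exI[of _ "par (Min (part 3))"] exI[of _ "n"]) simp
  qed
qed

lemma level_own_part:
  assumes i: "i \<in> {1,2,3}" and k: "k \<le> s i" and v: "v \<in> set (Q i ! k)"
  shows "level (part i) v = k"
proof -
  obtain u w where uw: "u \<in> set (P i)" "level (part i) u = 0" "w \<in> set (P i)"
      "level (part i) w = s i" "u = hd (P i) \<or> w = last (P i)"
    using level_extremes[OF i] by blast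
  show ?thesis
  proof (rule segment_levels[where c = "level (part i)" and qs = "Q i" and s = "s i"
        and u = u and w = w and k = k and v = v])
    fix q x y assume q: "q \<in> set (Q i)" and xy: "x \<in> set q" "y \<in> set q"
    show "level (part i) x = level (part i) y"
    proof (rule constant_on_path[OF _ xy])
      fix x y assume "{x, y} \<in> path_edges q"
      then have e: "{x, y} \<in> path_edges (P i) - edge ` part i" using Q_facts(4)[OF i] q by blast
      show "level (part i) x = level (part i) y"
      proof (rule level_edge_eq)
        show "{x, y} \<in> E" using e Q_facts(5)[OF i] by blast
      qed (use e in blast)
    qed
  next
    fix j assume j: "j < s i"
    have "{hd (Q i ! Suc j), last (Q i ! j)} \<in> path_edges (P i)"
      using junction_in_path_edges[OF Q_facts(2)[OF i], of j] Q_facts(1)[OF i] length_Q[OF i] j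
      by (simp add: insert_commute)
    then have "{hd (Q i ! Suc j), last (Q i ! j)} \<in> E" using Q_facts(5)[OF i] by blast
    then show "level (part i) (hd (Q i ! Suc j)) \<le> Suc (level (part i) (last (Q i ! j)))"
      by (rule level_edge_le)
  qed (use uw k v length_Q[OF i] Q_facts[OF i] in simp_all)
qed

text \<open>
  The path \<open>P i\<close> has no edge of \<open>S\<^sub>j\<close> for \<open>j \<noteq> i\<close>, so these levels are constant along it and can be
  read off at its fixed end.
\<close>

lemma levels:
  assumes i: "i \<in> {1,2,3}" and k: "k \<le> s i" and v: "v \<in> set (Q i ! k)"
  shows "level (part 1) v = (if i = 1 then k else s 1)"
    and "level (part 2) v = (if i = 2 then k else 0)"
    and "level (part 3) v = (if i = 3 then k else 0)"
proof -
  have own: "level (part i) v = k" by (rule level_own_part[OF assms])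
  have vP: "v \<in> set (P i)"
    using Q_facts(1)[OF i] Q_nonempty(2)[OF i k] v by (metis UN_I set_concat)
  have other: "level (part j) v = level (part j) a" if "j \<in> {1,2,3}" "i \<noteq> j" "a \<in> set (P i)" for j a
    by (rule level_other_part[OF i that(1,2) vP that(3)])
  consider "i = 1" | "i = 2" | "i = 3" using i by blast
  then have "level (part 1) v = (if i = 1 then k else s 1) \<and>
      level (part 2) v = (if i = 2 then k else 0) \<and> level (part 3) v = (if i = 3 then k else 0)"
  proof cases
    case 1
    then show ?thesis using own other[of 2 1] other[of 3 1] anchors(1) level_root by simp
  next
    case 2
    then show ?thesis using own other[of 1 n1] other[of 3 n1] anchors(2) level_n1 by simp
  next
    case 3
    then show ?thesis using own other[of 1 n] other[of 2 n] anchors(3) level_n by simp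
  qed
  then show "level (part 1) v = (if i = 1 then k else s 1)"
    "level (part 2) v = (if i = 2 then k else 0)" "level (part 3) v = (if i = 3 then k else 0)"
    by auto
qed

section \<open>The extremal signal\<close>

text \<open>
  The weight of the segment of \<open>v\<close>, expressed through the levels alone. The last case also covers
  the first segments of \<open>P 2\<close> and \<open>P 3\<close>, which have the levels, and by the balance condition the
  weight, of the last segment of \<open>P 1\<close>.
\<close>

definition amplitude :: "nat \<Rightarrow> real" where
  "amplitude v =
     (if level (part 2) v > 0 then seg_weight (Q 2) (level (part 2) v)
      else if level (part 3) v > 0 then seg_weight (Q 3) (level (part 3) v)
      else seg_weight (Q 1) (level (part 1) v))"

definition extremal :: "nat \<Rightarrow> real" where
  "extremal v =
     (-1) ^ (level (part 1) v + level (part 2) v + level (part 3) v) * amplitude v"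

lemma amplitude_eq:
  assumes i: "i \<in> {1,2,3}" and k: "k \<le> s i" and v: "v \<in> set (Q i ! k)"
  shows "amplitude v = seg_weight (Q i) k"
proof -
  have "seg_weight (Q 1) (s 1) = seg_weight (Q 2) 0" "seg_weight (Q 2) 0 = seg_weight (Q 3) 0"
    using balanced length_Q[of 1] by (simp_all add: seg_weight_def)
  then show ?thesis
    using levels[OF assms] i by (auto simp: amplitude_def)
qed

lemma extremal_sq:
  assumes "i \<in> {1,2,3}" and "k \<le> s i" and "v \<in> set (Q i ! k)"
  shows "(extremal v)\<^sup>2 = (seg_weight (Q i) k)\<^sup>2"
  by (simp add: extremal_def amplitude_eq[OF assms] power_mult_distrib flip: power_mult)

text \<open>
  This includes the deleted edges: they lie outside \<open>S\<close>, so their ends have equal levels.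
\<close>

lemma extremal_non_S:
  assumes "k \<in> {1..n} - ({1} \<union> S)"
  shows "extremal k = extremal (par k)"
proof -
  have "2 \<le> k" "k \<notin> part j" for j using assms part_subset(1)[of j] by auto
  then have "level (part j) k = level (part j) (par k)" for j using level_step by simp
  then show ?thesis by (simp add: extremal_def amplitude_def)
qed

lemma seg_weight_nonneg: "seg_weight qs k \<ge> 0"
  by (simp add: seg_weight_def)

lemma extremal_jump:
  assumes i: "i \<in> {1,2,3}" and k: "k < s i"
  shows "\<bar>extremal (last (Q i ! k)) - extremal (hd (Q i ! Suc k))\<bar> =
    seg_weight (Q i) k + seg_weight (Q i) (Suc k)"
proof -
  let ?u = "last (Q i ! k)" and ?v = "hd (Q i ! Suc k)"
  have u: "k \<le> s i" "?u \<in> set (Q i ! k)" using Q_nonempty(1)[OF i, of k] k by auto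
  have v: "Suc k \<le> s i" "?v \<in> set (Q i ! Suc k)" using Q_nonempty(1)[OF i, of "Suc k"] k by auto
  define m where "m = level (part 1) ?u + level (part 2) ?u + level (part 3) ?u"
  have "level (part 1) ?v + level (part 2) ?v + level (part 3) ?v = Suc m"
    using levels[OF i u] levels[OF i v] i by (auto simp: m_def)
  then have "extremal ?u - extremal ?v =
      (-1) ^ m * (seg_weight (Q i) k + seg_weight (Q i) (Suc k))"
    using amplitude_eq[OF i u] amplitude_eq[OF i v]
    by (simp add: extremal_def m_def algebra_simps)
  then show ?thesis
    using seg_weight_nonneg[of "Q i" k] seg_weight_nonneg[of "Q i" "Suc k"]
    by (simp add: abs_mult power_abs)
qed

lemma excess_extremal: "excess extremal = energy"
proof -
  have "(\<Sum>k\<in>{1..n} - ({1} \<union> S). \<bar>extremal k - extremal (par k)\<bar>) = 0"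
    by (rule sum.neutral) (use extremal_non_S in force)
  moreover have "(\<Sum>k\<in>part i. \<bar>extremal k - extremal (par k)\<bar>) = cut_energy (Q i)"
    if i: "i \<in> {1,2,3}" for i
  proof -
    have "(\<Sum>k\<in>part i. \<bar>extremal k - extremal (par k)\<bar>)
        = (\<Sum>k<s i. seg_weight (Q i) k + seg_weight (Q i) (Suc k))"
      unfolding sum_over_part[OF i] using extremal_jump[OF i] by (intro sum.cong) auto
    also have "\<dots> = cut_energy (Q i)"
      by (rule cut_energy_eq_jumps[OF Q_facts(2)[OF i] length_Q[OF i] s_pos[OF i]])
    finally show ?thesis .
  qed
  then have "(\<Sum>k\<in>S. \<bar>extremal k - extremal (par k)\<bar>) = energy"
    unfolding sum_over_S energy_def by (rule sum.cong[OF refl])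
  ultimately show ?thesis by (simp add: excess_def)
qed

lemma norm_extremal: "(\<Sum>v=1..n. (extremal v)\<^sup>2) = energy"
proof -
  have "(\<Sum>v=1..n. (extremal v)\<^sup>2) =
      (\<Sum>i\<in>{1,2,3}. \<Sum>k<Suc (s i). \<Sum>v\<in>set (Q i ! k). (seg_weight (Q i) k)\<^sup>2)"
    unfolding sum_over_vertices using extremal_sq by (intro sum.cong refl) auto
  then show ?thesis using sum_weights_sq by simp
qed

lemma excess_scale:
  assumes "c \<ge> 0"
  shows "excess (\<lambda>v. c * f v) = c * excess f"
proof -
  have "\<bar>c * x - c * y\<bar> = c * \<bar>x - y\<bar>" for x y :: real
    using assms by (simp add: abs_mult flip: right_diff_distrib)
  then show ?thesis by (simp only: excess_def sum_distrib_left right_diff_distrib)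
qed

section \<open>The compatibility constant\<close>

lemma l1_excess:
  assumes "\<And>k. k \<in> {2..n} \<Longrightarrow> \<beta> k = f k - f (par k)"
  shows "l1_on S \<beta> - l1_on ({1..n} - ({1} \<union> S)) \<beta> = excess f"
proof -
  have "(\<Sum>k\<in>S. \<bar>\<beta> k\<bar>) = (\<Sum>k\<in>S. \<bar>f k - f (par k)\<bar>)"
    using assms S_subset by (intro sum.cong) auto
  moreover have "(\<Sum>k\<in>{1..n} - ({1} \<union> S). \<bar>\<beta> k\<bar>) =
      (\<Sum>k\<in>{1..n} - ({1} \<union> S). \<bar>f k - f (par k)\<bar>)"
    using assms by (intro sum.cong) auto
  ultimately show ?thesis by (simp add: l1_on_def excess_def)
qed

text \<open>
  The extremal signal has excess and squared norm both equal to \<open>energy\<close>; dividing it by \<open>energy\<close>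
  makes it feasible with squared norm \<open>1 / energy\<close>.
\<close>

lemma compat_minimum:
  defines "m \<equiv> (real (card S) + 1) / real n * (1 / energy)"
  shows "m \<in> compat_values n1 n2 b S" and "\<And>x. x \<in> compat_values n1 n2 b S \<Longrightarrow> m \<le> x"
proof -
  let ?X = "path_matrix n1 n2 b"
  define f where "f = (\<lambda>v. 1 / energy * extremal v)"
  have "excess f = 1"
    using excess_scale[of "1 / energy" extremal] excess_extremal energy_pos by (simp add: f_def)
  then have feasible: "l1_on S (increments f) - l1_on ({1..n} - ({1} \<union> S)) (increments f) = 1"
    using l1_excess[of "increments f" f] by (simp add: increments_def)
  have "(\<Sum>v=1..n. (mat_vec n ?X (increments f) v)\<^sup>2) = (\<Sum>v=1..n. (f v)\<^sup>2)"
    by (intro sum.cong) (auto simp: mat_vec_increments)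
  also have "\<dots> = (1 / energy)\<^sup>2 * (\<Sum>v=1..n. (extremal v)\<^sup>2)"
    by (simp only: f_def power_mult_distrib sum_distrib_left)
  also have "\<dots> = 1 / energy"
    unfolding norm_extremal using energy_pos by (simp add: power2_eq_square)
  finally have "m = (real (card S) + 1) * emp_norm_sq n (mat_vec n ?X (increments f))"
    by (simp add: m_def emp_norm_sq_def)
  then show "m \<in> compat_values n1 n2 b S" using feasible by (auto simp: compat_values_def)
  fix x assume "x \<in> compat_values n1 n2 b S"
  then obtain \<beta> where x: "x = (real (card S) + 1) * emp_norm_sq n (mat_vec n ?X \<beta>)"
      and "l1_on S \<beta> - l1_on ({1..n} - ({1} \<union> S)) \<beta> = 1"
    by (auto simp: compat_values_def)
  then have "excess (mat_vec n ?X \<beta>) = 1"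
    using l1_excess[of \<beta> "mat_vec n ?X \<beta>"] mat_vec_step by simp
  from norm_bound[OF this]
  have "(real (card S) + 1) / real n * (1 / energy)
      \<le> (real (card S) + 1) / real n * (\<Sum>v=1..n. (mat_vec n ?X \<beta> v)\<^sup>2)"
    by (rule mult_left_mono) simp
  then show "m \<le> x" by (simp add: m_def x emp_norm_sq_def)
qed

end

theorem corollary5p2:
  fixes n n1 n2 b :: nat and S :: "nat set" and s :: "nat \<Rightarrow> nat"
    and P :: "nat \<Rightarrow> nat list" and d :: "nat \<Rightarrow> nat \<Rightarrow> nat"
  assumes "n = n1 + n2" and "1 \<le> b" and "b < n1"
    and "S \<subseteq> {2..n}"
    and "\<And>i. s i = card (S_part n1 n2 b S i)"
    and "admissible_decomposition n1 n2 b S P d"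
    and "\<And>i j. i \<in> {1,2,3} \<Longrightarrow> j \<in> {2..s i} \<Longrightarrow> even (d i j)"
    and "d 1 (s 1 + 1) = d 2 1" and "d 2 1 = d 3 1"
  shows "kappa_sq n1 n2 b S \<in> compat_values n1 n2 b S \<and>
         kappa_sq n1 n2 b S = (real (card S) + 1) / real n * (1 / K_branch s d)"
proof -
  have adm: "\<forall>i\<in>{1,2,3}. is_path (bp_vertices n1 n2) (bp_edges n1 n2 b) (P i)"
      "(\<Union>i\<in>{1,2,3}. set (P i)) = bp_vertices n1 n2"
      "\<forall>i\<in>{1,2,3}. \<forall>j\<in>{1,2,3}. i \<noteq> j \<longrightarrow> set (P i) \<inter> set (P j) = {}"
      "hd (P 1) = 1" "last (P 2) = n1" "last (P 3) = n1 + n2"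
    and seg: "\<forall>i\<in>{1,2,3}. s i \<ge> 1 \<and>
      {k \<in> S. bp_edge n1 b k \<in> path_edges (P i)} = S_part n1 n2 b S i \<and>
      (\<exists>qs. cuts_into (bp_edge n1 b ` S_part n1 n2 b S i) (P i) qs \<and>
        length qs = s i + 1 \<and> (\<forall>j\<in>{1..s i + 1}. d i j = length (qs ! (j - 1)))) \<and>
      d i 1 \<ge> 2 \<and> d i (s i + 1) \<ge> 2 \<and> (\<forall>j\<in>{2..s i}. d i j \<ge> 4)"
    using assms(6)[unfolded admissible_decomposition_def Let_def, folded assms(5)]
    by - (elim conjE, assumption)+
  have "\<forall>i\<in>{1,2,3}. \<exists>qs. cuts_into (bp_edge n1 b ` S_part n1 n2 b S i) (P i) qs \<and>
      length qs = s i + 1 \<and> (\<forall>j\<in>{1..s i + 1}. d i j = length (qs ! (j - 1)))"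
    using seg by blast
  then obtain Q where Q: "\<forall>i\<in>{1,2,3}. cuts_into (bp_edge n1 b ` S_part n1 n2 b S i) (P i) (Q i) \<and>
      length (Q i) = s i + 1 \<and> (\<forall>j\<in>{1..s i + 1}. d i j = length (Q i ! (j - 1)))"
    by (elim bchoice[THEN exE])
  have d: "d i (Suc k) = length (Q i ! k)" if "i \<in> {1,2,3}" "k \<le> s i" for i k
    using bspec[OF Q that(1)] that(2) by force
  have pos: "s i \<ge> 1" if "i \<in> {1,2,3}" for i using seg that by blast
  interpret branch_decomposition n1 n2 b S P s Q
  proof unfold_locales
    show "even (length (Q i ! k))" if "i \<in> {1,2,3}" "0 < k" "k < s i" for i k
      using assms(7)[of i "Suc k"] d[of i k] that by simp
    show "length (Q 1 ! s 1) = length (Q 2 ! 0)" "length (Q 2 ! 0) = length (Q 3 ! 0)"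
      using d[of 1 "s 1"] d[of 2 0] d[of 3 0] assms(8,9) by simp_all
    show "card (S_part n1 n2 b S i) = s i" for i by (simp add: assms(5))
    show "S \<subseteq> {2..n1 + n2}" using assms(1,4) by simp
    show "length (Q i) = Suc (s i)" if "i \<in> {1,2,3}" for i using Q that by auto
    show "cuts_into (bp_edge n1 b ` S_part n1 n2 b S i) (P i) (Q i)" if "i \<in> {1,2,3}" for i
      using Q that by blast
    show "{k \<in> S. bp_edge n1 b k \<in> path_edges (P i)} = S_part n1 n2 b S i" if "i \<in> {1,2,3}" for i
      using bspec[OF seg that] by (elim conjE)
    show "is_path (bp_vertices n1 n2) (bp_edges n1 n2 b) (P i)" if "i \<in> {1,2,3}" for i
      by (rule bspec[OF adm(1) that])
    show "set (P i) \<inter> set (P j) = {}" if "i \<in> {1,2,3}" "j \<in> {1,2,3}" "i \<noteq> j" for i j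
      using adm(3) that by blast
  qed (fact adm assms(2,3) pos)+
  have "energy = (\<Sum>i\<in>{1,2,3}. 1 / real (d i 1) + (\<Sum>j=2..s i. 4 / real (d i j))
      + 1 / real (d i (s i + 1)))"
    unfolding energy_def
  proof (rule sum.cong[OF refl])
    fix i :: nat assume i: "i \<in> {1,2,3}"
    show "cut_energy (Q i) = 1 / real (d i 1) + (\<Sum>j=2..s i. 4 / real (d i j))
        + 1 / real (d i (s i + 1))"
      by (rule cut_energy_formula[OF Q_facts(2)[OF i] length_Q[OF i] pos[OF i] d[OF i]])
  qed
  also have "{1,2,3} = {1..3::nat}" by auto
  finally have "energy = K_branch s d" by (simp only: K_branch_def)
  then have "(real (card S) + 1) / real n * (1 / K_branch s d) \<in> compat_values n1 n2 b S"
    and "\<And>x. x \<in> compat_values n1 n2 b S \<Longrightarrow>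
      (real (card S) + 1) / real n * (1 / K_branch s d) \<le> x"
    using compat_minimum assms(1) by simp_all
  then show ?thesis
    unfolding kappa_sq_def using cInf_eq_minimum by metis
qed

end
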